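(* Let $\mathbb{M}=(V,\mathcal{C})$ be a simple binary matroid, $\mathcal{D}$ its family of chordless circuits, and $h_{\mathbb{M}}=\Phi_{\mathcal{C}}$. Then $\mathcal{D}$ is the unique minimum-cardinality subfamily $\mathcal{D}'\subseteq\mathcal{C}$ with $\Phi_{\mathcal{D}'}=h_{\mathbb{M}}$. Furthermore, $\{(C\setminus\{v\})\to v: C\in\mathcal{D},\ v\in C\}$ is the unique minimum-cardinality set of circuit clauses whose conjunction equals $h_{\mathbb{M}}$.
   Context: A binary matroid is one representable over GF(2); simple means no loops and no parallel elements; $\mathcal{C}$ is the family of circuits. A circuit $C$ is chordless if there is no $C'\in\mathcal{C}$ with $|C'\setminus C|=1$ and $|C'|<|C|$. Boolean functions on $V$ are viewed as functions of subsets; the clause $B\to v$ ($v\notin B$) has true sets the $T$ with $B\not\subseteq T$ or $B\cup\{v\}\subseteq T$; $\Phi_{\mathcal{H}}=\bigwedge_{H\in\mathcal{H}}\bigwedge_{v\in H}((H\setminus\{v\})\to v)$. A circuit clause is a clause $(C\setminus\{v\})\to v$ with $C\in\mathcal{C}$, $v\in C$. *)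

theory Defs
  imports Complex_Main "HOL-Library.Function_Algebras" "HOL-Library.Z2"
begin

locale matroid =
  fixes V :: "'a set" and \<C> :: "'a set set"
  assumes finite_ground: "finite V"
    and circuits_subset: "C \<in> \<C> \<Longrightarrow> C \<subseteq> V"
    and empty_not_circuit: "{} \<notin> \<C>"
    and circuits_incomparable: "C \<in> \<C> \<Longrightarrow> C' \<in> \<C> \<Longrightarrow> C \<subseteq> C' \<Longrightarrow> C = C'"
    and circuit_elimination:
      "C \<in> \<C> \<Longrightarrow> C' \<in> \<C> \<Longrightarrow> C \<noteq> C' \<Longrightarrow> e \<in> C \<inter> C' \<Longrightarrow>
        \<exists>C''\<in>\<C>. C'' \<subseteq> (C \<union> C') - {e}"

definition matroid_indep :: "'a set \<Rightarrow> 'a set set \<Rightarrow> 'a set \<Rightarrow> bool" where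
  "matroid_indep V \<C> S \<longleftrightarrow> S \<subseteq> V \<and> (\<forall>C\<in>\<C>. \<not> C \<subseteq> S)"

definition loop :: "'a set set \<Rightarrow> 'a \<Rightarrow> bool" where
  "loop \<C> v \<longleftrightarrow> {v} \<in> \<C>"

definition parallel :: "'a set set \<Rightarrow> 'a \<Rightarrow> 'a \<Rightarrow> bool" where
  "parallel \<C> u v \<longleftrightarrow> u \<noteq> v \<and> {u, v} \<in> \<C>"

definition simple_matroid :: "'a set \<Rightarrow> 'a set set \<Rightarrow> bool" where
  "simple_matroid V \<C> \<longleftrightarrow> matroid V \<C> \<and>
     (\<forall>v\<in>V. \<not> loop \<C> v) \<and> (\<forall>u\<in>V. \<forall>v\<in>V. \<not> parallel \<C> u v)"

text \<open>
  Since the ground set is finite, only finitely many dimensions are needed to represent it.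
  The sequence space over GF(2) contains a copy of every finite-dimensional one, so it can
  serve as the target of all representations.
\<close>

definition gf2_scale :: "bit \<Rightarrow> (nat \<Rightarrow> bit) \<Rightarrow> (nat \<Rightarrow> bit)" where
  "gf2_scale c x = (\<lambda>i. c * x i)"

global_interpretation gf2: vector_space gf2_scale
  by unfold_locales (auto simp: gf2_scale_def fun_eq_iff algebra_simps)

text \<open>
  A representation assigns a vector to each element, possibly the same one to several elements.
  A set of elements is linearly independent as a family iff the assignment is injective
  on it and its image is linearly independent as a set.
\<close>

definition binary_matroid :: "'a set \<Rightarrow> 'a set set \<Rightarrow> bool" where
  "binary_matroid V \<C> \<longleftrightarrow> matroid V \<C> \<and>
     (\<exists>\<phi> :: 'a \<Rightarrow> nat \<Rightarrow> bit. \<forall>S. S \<subseteq> V \<longrightarrow>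
        (matroid_indep V \<C> S \<longleftrightarrow> inj_on \<phi> S \<and> gf2.independent (\<phi> ` S)))"

definition chordless :: "'a set set \<Rightarrow> 'a set \<Rightarrow> bool" where
  "chordless \<C> C \<longleftrightarrow> \<not> (\<exists>C'\<in>\<C>. card (C' - C) = 1 \<and> card C' < card C)"

definition chordless_circuits :: "'a set set \<Rightarrow> 'a set set" where
  "chordless_circuits \<C> = {C \<in> \<C>. chordless \<C> C}"

text \<open>
  A Boolean function on a finite set \<open>V\<close> is a predicate on sets, of which only the values
  at subsets of \<open>V\<close> are relevant; \<open>bf_eq\<close> is the corresponding equality.
  The clause \<open>B \<rightarrow> v\<close> is encoded as the pair \<open>(B, v)\<close>.  Distinct pairs with
  \<open>B \<subseteq> V\<close> and \<open>v \<in> V - B\<close> denote distinct Boolean functions, so cardinalities of sets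
  of clauses do not depend on this encoding.
\<close>

definition bf_eq :: "'a set \<Rightarrow> ('a set \<Rightarrow> bool) \<Rightarrow> ('a set \<Rightarrow> bool) \<Rightarrow> bool" where
  "bf_eq V f g \<longleftrightarrow> (\<forall>T. T \<subseteq> V \<longrightarrow> f T = g T)"

type_synonym 'a clause = "'a set \<times> 'a"

definition clause_fun :: "'a clause \<Rightarrow> 'a set \<Rightarrow> bool" where
  "clause_fun c T \<longleftrightarrow> (case c of (B, v) \<Rightarrow> \<not> B \<subseteq> T \<or> B \<union> {v} \<subseteq> T)"

definition clauses_fun :: "'a clause set \<Rightarrow> 'a set \<Rightarrow> bool" where
  "clauses_fun K T \<longleftrightarrow> (\<forall>c\<in>K. clause_fun c T)"

definition clauses_of :: "'a set set \<Rightarrow> 'a clause set" where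
  "clauses_of \<H> = {(H - {v}, v) | H v. H \<in> \<H> \<and> v \<in> H}"

definition \<Phi> :: "'a set set \<Rightarrow> 'a set \<Rightarrow> bool" where
  "\<Phi> \<H> T \<longleftrightarrow> (\<forall>H\<in>\<H>. \<forall>v\<in>H. clause_fun (H - {v}, v) T)"

definition unique_min_card :: "('b set \<Rightarrow> bool) \<Rightarrow> 'b set \<Rightarrow> bool" where
  "unique_min_card P X \<longleftrightarrow>
     is_arg_min card P X \<and> (\<forall>Y. is_arg_min card P Y \<longrightarrow> Y = X)"

end

(*
  A representation over GF(2) turns circuits into the minimal nonempty sets of zero sum.  If a
  circuit C has a chord e, witnessed by C', then C' and the symmetric difference of C and C' are
  both smaller than C (the latter because C' has at least three elements), and the clauses of C
  follow by chaining clauses of circuits contained in these two sets, first deriving e.  Hence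
  the clauses of chordless circuits imply all others.  Conversely, if C is chordless and v is in C,
  then C - {v} violates the clause (C - {v}) -> v and no other circuit clause, so this clause
  cannot be omitted.
*)

theory Submission imports Defs begin

text \<open>A finite superset of \<open>X\<close> of no larger cardinality equals \<open>X\<close>.
  Both uniqueness claims thus reduce to inclusions; finiteness matters because \<open>card\<close>
  is 0 on infinite sets.\<close>

lemma unique_min_card_least:
  assumes "P X" and "\<And>Y. P Y \<Longrightarrow> finite Y \<and> X \<subseteq> Y"
  shows "unique_min_card P X"
  unfolding unique_min_card_def
proof (intro conjI allI impI)
  show "is_arg_min card P X"
    using assms by (simp add: is_arg_min_linorder card_mono)
next
  fix Y assume "is_arg_min card P Y"
  then have "P Y" and "card Y \<le> card X"
    using assms(1) by (simp_all add: is_arg_min_linorder)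
  then show "Y = X"
    using assms(2) card_seteq by metis
qed

section \<open>Zero-sum sets over GF(2)\<close>

lemma gf2_add_self [simp]: "x + x = (0 :: nat \<Rightarrow> bit)"
  by (simp add: fun_eq_iff)

lemma sum_gf2_sym_diff:
  fixes \<phi> :: "'a \<Rightarrow> nat \<Rightarrow> bit"
  assumes "finite A" "finite B"
  shows "sum \<phi> ((A - B) \<union> (B - A)) = sum \<phi> A + sum \<phi> B"
proof -
  have "sum \<phi> A = sum \<phi> (A - B) + sum \<phi> (A \<inter> B)"
    using sum.Int_Diff[OF assms(1), of \<phi> B] by (simp add: add.commute)
  moreover have "sum \<phi> B = sum \<phi> (B - A) + sum \<phi> (A \<inter> B)"
    using sum.Int_Diff[OF assms(2), of \<phi> A] by (simp add: add.commute Int_commute)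
  moreover have "sum \<phi> ((A - B) \<union> (B - A)) = sum \<phi> (A - B) + sum \<phi> (B - A)"
    using assms by (intro sum.union_disjoint) auto
  moreover have "x + y = (x + z) + (y + z)" for x y z :: "nat \<Rightarrow> bit"
  proof -
    have "(x + z) + (y + z) = (x + y) + (z + z)"
      by (simp only: ac_simps)
    then show ?thesis by simp
  qed
  ultimately show ?thesis by metis
qed

lemma gf2_scale_if: "gf2_scale c x = (if c = 0 then 0 else x)"
  by (cases c) (auto simp: gf2_scale_def fun_eq_iff)

text \<open>Coefficients in GF(2) are 0 or 1, so a linear combination is the sum over a subset. A
  failure of injectivity also fits, since two equal vectors sum to zero.\<close>

lemma gf2_independent_family_iff:
  fixes \<phi> :: "'a \<Rightarrow> nat \<Rightarrow> bit"
  assumes "finite S"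
  shows "inj_on \<phi> S \<and> gf2.independent (\<phi> ` S) \<longleftrightarrow>
    \<not> (\<exists>Z\<subseteq>S. Z \<noteq> {} \<and> sum \<phi> Z = 0)"
proof (cases "inj_on \<phi> S")
  case False
  then obtain a b where ab: "a \<in> S" "b \<in> S" "a \<noteq> b" "\<phi> a = \<phi> b"
    by (auto simp: inj_on_def)
  then have "{a, b} \<subseteq> S \<and> {a, b} \<noteq> {} \<and> sum \<phi> {a, b} = 0" by simp
  with False show ?thesis by blast
next
  case True
  have "gf2.dependent (\<phi> ` S) \<longleftrightarrow> (\<exists>Z\<subseteq>S. Z \<noteq> {} \<and> sum \<phi> Z = 0)"
  proof
    assume "gf2.dependent (\<phi> ` S)"
    then obtain u where u: "\<exists>x\<in>\<phi> ` S. u x \<noteq> 0" "(\<Sum>x\<in>\<phi> ` S. gf2_scale (u x) x) = 0"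
      using assms by (auto simp: gf2.dependent_finite)
    \<comment> \<open>The support of the coefficients, pulled back along
      \<open>\<phi>\<close>.\<close>
    let ?Z = "{s \<in> S. u (\<phi> s) \<noteq> 0}"
    have "sum \<phi> ?Z = (\<Sum>s\<in>S. gf2_scale (u (\<phi> s)) (\<phi> s))"
      using assms by (auto simp: gf2_scale_if intro!: sum.mono_neutral_cong_left)
    also have "\<dots> = 0"
      using u(2) True by (simp add: sum.reindex)
    finally show "\<exists>Z\<subseteq>S. Z \<noteq> {} \<and> sum \<phi> Z = 0"
      using u(1) by (intro exI[of _ ?Z]) auto
  next
    assume "\<exists>Z\<subseteq>S. Z \<noteq> {} \<and> sum \<phi> Z = 0"
    then obtain Z where Z: "Z \<subseteq> S" "Z \<noteq> {}" "sum \<phi> Z = 0" by blast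
    let ?u = "\<lambda>x. if x \<in> \<phi> ` Z then 1 else 0 :: bit"
    have "(\<Sum>x\<in>\<phi> ` S. gf2_scale (?u x) x) = (\<Sum>x\<in>\<phi> ` Z. x)"
      using assms Z(1) by (auto simp: gf2_scale_if intro!: sum.mono_neutral_cong_right)
    also have "\<dots> = 0"
      using Z inj_on_subset[OF True Z(1)] by (simp add: sum.reindex)
    finally have "(\<Sum>x\<in>\<phi> ` S. gf2_scale (?u x) x) = 0" .
    moreover have "\<exists>x\<in>\<phi> ` S. ?u x \<noteq> 0" using Z by auto
    ultimately show "gf2.dependent (\<phi> ` S)"
      unfolding gf2.dependent_finite[OF finite_imageI[OF assms]] by (intro exI[of _ ?u] conjI)
  qed
  with True show ?thesis by blast
qed

section \<open>Clauses of set families\<close>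

lemma clause_fun_diff: "v \<in> H \<Longrightarrow> clause_fun (H - {v}, v) T \<longleftrightarrow> (H - {v} \<subseteq> T \<longrightarrow> v \<in> T)"
  by (auto simp: clause_fun_def)

lemma clauses_fun_clauses_of: "clauses_fun (clauses_of \<H>) = \<Phi> \<H>"
  by (auto simp: fun_eq_iff clauses_fun_def clauses_of_def \<Phi>_def)

lemma in_clauses_of_iff: "(B, v) \<in> clauses_of \<H> \<longleftrightarrow> v \<notin> B \<and> insert v B \<in> \<H>"
proof
  assume "(B, v) \<in> clauses_of \<H>"
  then show "v \<notin> B \<and> insert v B \<in> \<H>"
    by (auto simp: clauses_of_def insert_absorb)
next
  assume "v \<notin> B \<and> insert v B \<in> \<H>"
  then show "(B, v) \<in> clauses_of \<H>"
    unfolding clauses_of_def by (intro CollectI exI[of _ "insert v B"] exI[of _ v]) auto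
qed

text \<open>Fixes one representation \<open>\<phi>\<close>, so that all later arguments can compute
  with the same vectors.\<close>

locale simple_binary_representation = matroid V \<C>
  for V :: "'a set" and \<C> :: "'a set set" +
  fixes \<phi> :: "'a \<Rightarrow> nat \<Rightarrow> bit"
  assumes no_loop: "v \<in> V \<Longrightarrow> \<not> loop \<C> v"
    and no_parallel: "u \<in> V \<Longrightarrow> v \<in> V \<Longrightarrow> \<not> parallel \<C> u v"
    and indep_iff: "S \<subseteq> V \<Longrightarrow>
      matroid_indep V \<C> S \<longleftrightarrow> inj_on \<phi> S \<and> gf2.independent (\<phi> ` S)"
begin

lemma finite_circuit: "C \<in> \<C> \<Longrightarrow> finite C"
  using circuits_subset finite_ground finite_subset by blast

lemma finite_circuits: "finite \<C>"
  using circuits_subset finite_ground by (meson Pow_iff finite_Pow_iff finite_subset subsetI)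

text \<open>Each side expresses dependence of \<open>S\<close>, once through circuits and once
  through the vectors.\<close>

lemma contains_circuit_iff:
  assumes "S \<subseteq> V"
  shows "(\<exists>C\<in>\<C>. C \<subseteq> S) \<longleftrightarrow> (\<exists>Z\<subseteq>S. Z \<noteq> {} \<and> sum \<phi> Z = 0)"
  using indep_iff[OF assms] gf2_independent_family_iff[of S \<phi>] assms
    finite_subset[OF assms finite_ground]
  by (simp add: matroid_indep_def) blast

lemma sum_circuit:
  assumes "C \<in> \<C>"
  shows "sum \<phi> C = 0"
proof -
  obtain Z where Z: "Z \<subseteq> C" "Z \<noteq> {}" "sum \<phi> Z = 0"
    using contains_circuit_iff[OF circuits_subset[OF assms]] assms by blast
  then obtain C' where "C' \<in> \<C>" "C' \<subseteq> Z"
    using contains_circuit_iff[of Z] circuits_subset[OF assms] by blast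
  \<comment> \<open>The circuit \<open>C'\<close> lies in \<open>Z\<close> and hence in
    \<open>C\<close>, so \<open>C'\<close> equals \<open>C\<close> and \<open>Z\<close> is squeezed
    between them.\<close>
  then have "Z = C"
    using circuits_incomparable assms Z(1) by blast
  with Z show ?thesis by simp
qed

text \<open>Removing from \<open>Z\<close> a circuit that misses \<open>v\<close> leaves a smaller
  zero-sum set that still contains \<open>v\<close>.\<close>

lemma circuit_through:
  assumes "Z \<subseteq> V" "sum \<phi> Z = 0" "v \<in> Z"
  shows "\<exists>C\<in>\<C>. v \<in> C \<and> C \<subseteq> Z"
  using assms
proof (induction "card Z" arbitrary: Z rule: less_induct)
  case less
  then have fin: "finite Z"
    using finite_ground finite_subset by blast
  obtain C where C: "C \<in> \<C>" "C \<subseteq> Z"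
    using contains_circuit_iff[OF less.prems(1)] less.prems by blast
  show ?case
  proof (cases "v \<in> C")
    case True
    with C show ?thesis by blast
  next
    case False
    have "sum \<phi> (Z - C) = 0"
      using sum.subset_diff[OF C(2) fin, of \<phi>] sum_circuit[OF C(1)] less.prems(2) by simp
    moreover have "card (Z - C) < card Z"
    proof (rule psubset_card_mono[OF fin])
      have "C \<noteq> {}" using C(1) empty_not_circuit by auto
      then show "Z - C \<subset> Z" using C(2) by blast
    qed
    ultimately show ?thesis
      using less.hyps[of "Z - C"] less.prems False by blast
  qed
qed

text \<open>Common elements cancel in characteristic 2, so the symmetric difference has zero sum.
  This sharpens circuit elimination: all of the intersection is avoided and \<open>v\<close> can be
  prescribed.\<close>

lemma circuit_through_sym_diff:
  assumes "C \<in> \<C>" "C' \<in> \<C>" "v \<in> (C - C') \<union> (C' - C)"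
  shows "\<exists>C''\<in>\<C>. v \<in> C'' \<and> C'' \<subseteq> (C - C') \<union> (C' - C)"
proof (rule circuit_through)
  show "(C - C') \<union> (C' - C) \<subseteq> V"
    using assms circuits_subset by blast
  show "sum \<phi> ((C - C') \<union> (C' - C)) = 0"
    using assms by (simp add: sum_gf2_sym_diff finite_circuit sum_circuit)
qed (fact assms(3))

lemma card_circuit_ge_3:
  assumes "C \<in> \<C>"
  shows "3 \<le> card C"
proof (rule ccontr)
  assume "\<not> 3 \<le> card C"
  moreover have "card C \<noteq> 0"
    using assms finite_circuit empty_not_circuit by auto
  ultimately consider "card C = 1" | "card C = 2" by linarith
  then show False
  proof cases
    case 1
    then obtain v where "C = {v}" by (auto simp: card_1_singleton_iff)
    then show False
      using assms no_loop[of v] circuits_subset by (auto simp: loop_def)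
  next
    case 2
    then obtain u v where "C = {u, v}" "u \<noteq> v" by (auto simp: card_2_iff)
    then show False
      using assms no_parallel[of u v] circuits_subset[OF assms] by (auto simp: parallel_def)
  qed
qed

section \<open>Chordless circuits suffice\<close>

lemma chordless_closed_imp_closed:
  assumes T: "\<Phi> (chordless_circuits \<C>) T"
  shows "\<Phi> \<C> T"
proof -
  have "v \<in> T" if "C \<in> \<C>" "v \<in> C" "C - {v} \<subseteq> T" for C v
    using that
  \<comment> \<open>The head \<open>v\<close> varies because smaller circuits are used to derive the
    chord \<open>e\<close> as well as \<open>v\<close>.\<close>
  proof (induction "card C" arbitrary: C v rule: less_induct)
    case less
    show ?case
    proof (cases "chordless \<C> C")
      case True
      then show ?thesis
        using T less.prems by (auto simp: \<Phi>_def chordless_circuits_def clause_fun_diff)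
    next
      case False
      then obtain C' where C': "C' \<in> \<C>" "card (C' - C) = 1" "card C' < card C"
        by (auto simp: chordless_def)
      then obtain e where e: "C' - C = {e}" by (auto simp: card_1_singleton_iff)
      let ?D = "(C - C') \<union> (C' - C)"
      have fin: "finite C" "finite C'" using less.prems C' finite_circuit by auto
      have "card C' = card (C' \<inter> C) + 1"
        using card_Int_Diff[OF fin(2), of C] C'(2) by simp
      \<comment> \<open>Only \<open>e\<close> lies in \<open>C'\<close> outside \<open>C\<close>.
        Passing from \<open>C\<close> to \<open>?D\<close> thus loses at least two elements and
        gains one.\<close>
      then have "2 \<le> card (C \<inter> C')"
        using card_circuit_ge_3[OF C'(1)] by (simp add: Int_commute)
      moreover have "card C = card (C \<inter> C') + card (C - C')"
        using card_Int_Diff[OF fin(1)] by simp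
      moreover have "card ?D \<le> card (C - C') + card (C' - C)"
        by (rule card_Un_le)
      ultimately have small: "card ?D < card C" using C'(2) by linarith
      have smaller: "card C'' < card C" if "C'' \<subseteq> ?D" for C''
        using card_mono[OF _ that] fin small by simp
      show ?thesis
      \<comment> \<open>Exactly one of \<open>C'\<close> and \<open>?D\<close> contains
        \<open>v\<close>, while both contain \<open>e\<close>. The one without \<open>v\<close>
        yields \<open>e\<close> from \<open>C - {v}\<close>; the other then yields
        \<open>v\<close>.\<close>
      proof (cases "v \<in> C'")
        case True
        obtain C'' where C'': "C'' \<in> \<C>" "e \<in> C''" "C'' \<subseteq> ?D"
          using circuit_through_sym_diff[OF less.prems(1) C'(1), of e] e by blast
        have "C'' - {e} \<subseteq> C - {v}" using C''(3) e True by blast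
        then have "e \<in> T"
          using less.hyps[OF smaller[OF C''(3)] C''(1,2)] less.prems(3) by simp
        then have "C' - {v} \<subseteq> T"
          using e less.prems(3) by auto
        then show ?thesis
          using less.hyps[OF C'(3) C'(1) True] by blast
      next
        case False
        have "C' - {e} \<subseteq> C - {v}" "e \<in> C'" using e False by auto
        then have "e \<in> T"
          using less.hyps[OF C'(3) C'(1), of e] less.prems(3) by simp
        obtain C'' where C'': "C'' \<in> \<C>" "v \<in> C''" "C'' \<subseteq> ?D"
          using circuit_through_sym_diff[OF less.prems(1) C'(1), of v] False less.prems(2) by blast
        have "C'' \<subseteq> insert e C" using C''(3) e by blast
        then have "C'' - {v} \<subseteq> T" using \<open>e \<in> T\<close> less.prems(3) by auto
        then show ?thesis
          using less.hyps[OF smaller[OF C''(3)] C''(1,2)] by blast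
      qed
    qed
  qed
  then show ?thesis by (simp add: \<Phi>_def clause_fun_diff)
qed

lemma \<Phi>_chordless_circuits: "\<Phi> (chordless_circuits \<C>) = \<Phi> \<C>"
proof
  fix T
  have "\<Phi> (chordless_circuits \<C>) T" if "\<Phi> \<C> T"
    using that by (simp add: \<Phi>_def chordless_circuits_def)
  then show "\<Phi> (chordless_circuits \<C>) T = \<Phi> \<C> T"
    using chordless_closed_imp_closed by blast
qed

section \<open>Clauses of chordless circuits are indispensable\<close>

lemma chordless_clause_violated_only:
  assumes C: "C \<in> \<C>" "chordless \<C> C" "v \<in> C"
    and D: "D \<in> \<C>" "u \<in> D"
    and viol: "\<not> clause_fun (D - {u}, u) (C - {v})"
  shows "D = C \<and> u = v"
proof -
  have sub: "D - {u} \<subseteq> C - {v}" and u: "u \<notin> C - {v}"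
    using viol D(2) by (auto simp: clause_fun_diff)
  have fin: "finite C" "finite D" using C D finite_circuit by auto
  show ?thesis
  proof (cases "u = v")
    case True
    then have "D \<subseteq> C" using sub C(3) by auto
    then show ?thesis using circuits_incomparable C D True by blast
  next
    case False
    then have "u \<notin> C" using u by blast
    then have diff: "D - C = {u}" using sub D(2) by blast
    \<comment> \<open>Otherwise \<open>D\<close> would witness a chord \<open>u\<close> of
      \<open>C\<close>.\<close>
    then have "card C \<le> card D"
      using C(2) D(1) by (auto simp: chordless_def not_less)
    then have "card (C - {v}) \<le> card (D - {u})"
      using C(3) D(2) fin by simp
    then have "D - {u} = C - {v}"
      using sub fin by (intro card_seteq) auto
    \<comment> \<open>The two circuits differ only by exchanging \<open>v\<close> for
      \<open>u\<close>, so their symmetric difference would contain a circuit with at most two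
      elements.\<close>
    then have sym: "(C - D) \<union> (D - C) = {u, v}"
      using diff C(3) D(2) False \<open>u \<notin> C\<close> by blast
    obtain C'' where "C'' \<in> \<C>" "C'' \<subseteq> {u, v}"
      using circuit_through_sym_diff[OF C(1) D(1), of u] unfolding sym by auto
    then have "3 \<le> card {u, v}"
      using card_circuit_ge_3[of C''] card_mono[of "{u, v}" C''] by simp
    then show ?thesis using False by simp
  qed
qed

text \<open>The set \<open>C - {v}\<close> falsifies \<open>\<Phi> \<C>\<close>, so some clause in
  \<open>K\<close> must fail there, and only one circuit clause does.\<close>

lemma chordless_clauses_necessary:
  assumes K: "K \<subseteq> clauses_of \<C>" "bf_eq V (clauses_fun K) (\<Phi> \<C>)"
  shows "clauses_of (chordless_circuits \<C>) \<subseteq> K"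
proof
  fix c assume "c \<in> clauses_of (chordless_circuits \<C>)"
  then obtain C v where c: "c = (C - {v}, v)" and C: "C \<in> \<C>" "chordless \<C> C" "v \<in> C"
    by (auto simp: clauses_of_def chordless_circuits_def)
  have "\<not> \<Phi> \<C> (C - {v})"
    using C by (auto simp: \<Phi>_def clause_fun_diff)
  moreover have "C - {v} \<subseteq> V"
    using circuits_subset[OF C(1)] by blast
  ultimately obtain d where d: "d \<in> K" "\<not> clause_fun d (C - {v})"
    using K(2) unfolding bf_eq_def clauses_fun_def by blast
  then obtain D u where "d = (D - {u}, u)" "D \<in> \<C>" "u \<in> D"
    using K(1) by (auto simp: clauses_of_def)
  then show "c \<in> K"
    using chordless_clause_violated_only[OF C] d c by blast
qed

text \<open>Reduces to clauses: a circuit is nonempty, and any one of its clauses determines it as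
  body plus head.\<close>

lemma chordless_circuits_necessary:
  assumes "\<D> \<subseteq> \<C>" "bf_eq V (\<Phi> \<D>) (\<Phi> \<C>)"
  shows "chordless_circuits \<C> \<subseteq> \<D>"
proof
  fix C assume C: "C \<in> chordless_circuits \<C>"
  then have "C \<noteq> {}"
    using empty_not_circuit by (auto simp: chordless_circuits_def)
  then obtain v where v: "v \<in> C" by blast
  have "clauses_of \<D> \<subseteq> clauses_of \<C>"
    using assms(1) by (auto simp: clauses_of_def)
  then have "clauses_of (chordless_circuits \<C>) \<subseteq> clauses_of \<D>"
    using assms(2) by (intro chordless_clauses_necessary) (simp_all add: clauses_fun_clauses_of)
  moreover have "(C - {v}, v) \<in> clauses_of (chordless_circuits \<C>)"
    using C v by (simp add: in_clauses_of_iff insert_absorb)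
  ultimately have "(C - {v}, v) \<in> clauses_of \<D>" by blast
  then show "C \<in> \<D>"
    using v by (simp add: in_clauses_of_iff insert_absorb)
qed

lemma finite_clauses_of_circuits: "finite (clauses_of \<C>)"
proof (rule finite_subset)
  show "clauses_of \<C> \<subseteq> Pow V \<times> V"
    using circuits_subset by (auto simp: clauses_of_def)
qed (use finite_ground in simp)

end

theorem theorem17:
  fixes V :: "'a set" and \<C> :: "'a set set"
  assumes "simple_matroid V \<C>" and "binary_matroid V \<C>"
  shows "unique_min_card (\<lambda>\<D>'. \<D>' \<subseteq> \<C> \<and> bf_eq V (\<Phi> \<D>') (\<Phi> \<C>)) (chordless_circuits \<C>) \<and>
         unique_min_card (\<lambda>K. K \<subseteq> clauses_of \<C> \<and> bf_eq V (clauses_fun K) (\<Phi> \<C>))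
           (clauses_of (chordless_circuits \<C>))"
proof -
  obtain \<phi> :: "'a \<Rightarrow> nat \<Rightarrow> bit" where
    "\<forall>S. S \<subseteq> V \<longrightarrow> (matroid_indep V \<C> S \<longleftrightarrow> inj_on \<phi> S \<and> gf2.independent (\<phi> ` S))"
    using assms(2) by (auto simp: binary_matroid_def)
  then interpret simple_binary_representation V \<C> \<phi>
    using assms(1)
    by (auto simp: simple_matroid_def simple_binary_representation_def
        simple_binary_representation_axioms_def)
  have sub: "chordless_circuits \<C> \<subseteq> \<C>"
    by (auto simp: chordless_circuits_def)
  then have "clauses_of (chordless_circuits \<C>) \<subseteq> clauses_of \<C>"
    by (auto simp: clauses_of_def)
  \<comment> \<open>Both chordless families are admissible by
    \<open>\<Phi>_chordless_circuits\<close> and least by the two necessity lemmas.\<close>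
  then show ?thesis
    using sub chordless_circuits_necessary chordless_clauses_necessary
      finite_subset[OF _ finite_circuits] finite_subset[OF _ finite_clauses_of_circuits]
    by (intro conjI unique_min_card_least)
      (auto simp: bf_eq_def clauses_fun_clauses_of \<Phi>_chordless_circuits)
qed

end
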